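(* Let $\alpha>0$, $\beta>0$, let $n\ge 1$ be an integer, let $\gamma\in(0,1)$, and let $R_0,R_1,\dots,R_n$ be the first $n+1$ upper record values from the Weibull distribution $W(\alpha,\beta)$. Let $B$ be the random set of all pairs $(a,b)\in(0,\infty)^2$ satisfying both $$\frac{\chi^2_{(2n),(1-\sqrt{1-\gamma})/2}}{2\sum_{i=0}^n\log\left(\frac{R_n}{R_i}\right)}<b<\frac{\chi^2_{(2n),(1+\sqrt{1-\gamma})/2}}{2\sum_{i=0}^n\log\left(\frac{R_n}{R_i}\right)}$$ and $$R_n\left(\frac{2}{\chi^2_{(2n+2),(1+\sqrt{1-\gamma})/2}}\right)^{1/b}<a<R_n\left(\frac{2}{\chi^2_{(2n+2),(1-\sqrt{1-\gamma})/2}}\right)^{1/b}.$$ Then $B$ is an exact $100(1-\gamma)\%$ joint confidence region for $(\alpha,\beta)$; that is, for all $\alpha,\beta>0$, $P\big((\alpha,\beta)\in B\big)=1-\gamma$.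
   Context: The Weibull distribution $W(\alpha,\beta)$ with parameters $\alpha,\beta>0$ has cumulative distribution function $F(x)=1-e^{-(x/\alpha)^\beta}$ for $x>0$. Upper record values: let $X_1,X_2,\dots$ be an infinite sequence of independent identically distributed random variables with the given distribution. Set $T_0=1$ and, for $k\ge 1$, $T_k=\min\{j: X_j>X_{T_{k-1}}\}$ (almost surely finite here). The upper record values are $R_k=X_{T_k}$, $k=0,1,2,\dots$. $\chi^2_{(k),\delta}$ denotes the $\delta$-quantile of the chi-square distribution with $k$ degrees of freedom, i.e. the point $c$ with $P(\chi^2_{(k)}\le c)=\delta$. *)

theory Defs
  imports "HOL-Probability.Probability"
begin

definition weibull_cdf :: "real \<Rightarrow> real \<Rightarrow> real \<Rightarrow> real" where
  "weibull_cdf \<alpha> \<beta> x = (if x > 0 then 1 - exp (- ((x / \<alpha>) powr \<beta>)) else 0)"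

(* Record times of the sequence (X j \<omega>), indexed from 0, so X 0 is the first observation and the
   first record time is 0. LEAST is unspecified if there is no further record (a null event for an
   i.i.d. sequence with continuous distribution). *)
fun record_time :: "(nat \<Rightarrow> 'a \<Rightarrow> real) \<Rightarrow> nat \<Rightarrow> 'a \<Rightarrow> nat" where
  "record_time X 0 \<omega> = 0"
| "record_time X (Suc k) \<omega> = (LEAST j. X j \<omega> > X (record_time X k \<omega>) \<omega>)"

definition record_value :: "(nat \<Rightarrow> 'a \<Rightarrow> real) \<Rightarrow> nat \<Rightarrow> 'a \<Rightarrow> real" where
  "record_value X k \<omega> = X (record_time X k \<omega>) \<omega>"

(* Meaningful for k \<ge> 1 degrees of freedom only. *)
definition chi_square_density :: "nat \<Rightarrow> real \<Rightarrow> real" where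
  "chi_square_density k x =
     (if x > 0 then x powr (real k / 2 - 1) * exp (- x / 2) / (2 powr (real k / 2) * Gamma (real k / 2))
      else 0)"

definition chi_square :: "nat \<Rightarrow> real measure" where
  "chi_square k = density lborel (\<lambda>x. ennreal (chi_square_density k x))"

(* The cdf of chi_square k is strictly increasing on the positive half-line, so the point c exists
   and is unique for k \<ge> 1 and 0 < \<delta> < 1. *)
definition chi_square_quantile :: "nat \<Rightarrow> real \<Rightarrow> real" where
  "chi_square_quantile k \<delta> = (THE c. cdf (chi_square k) c = \<delta>)"

(* The region B computed from the observed record values r 0, ..., r n. *)
definition confidence_region :: "nat \<Rightarrow> real \<Rightarrow> (nat \<Rightarrow> real) \<Rightarrow> (real \<times> real) set" where
  "confidence_region n \<gamma> r = {(a, b). a > 0 \<and> b > 0 \<and>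
     chi_square_quantile (2 * n) ((1 - sqrt (1 - \<gamma>)) / 2) / (2 * (\<Sum>i=0..n. ln (r n / r i))) < b \<and>
     b < chi_square_quantile (2 * n) ((1 + sqrt (1 - \<gamma>)) / 2) / (2 * (\<Sum>i=0..n. ln (r n / r i))) \<and>
     r n * (2 / chi_square_quantile (2 * n + 2) ((1 + sqrt (1 - \<gamma>)) / 2)) powr (1 / b) < a \<and>
     a < r n * (2 / chi_square_quantile (2 * n + 2) ((1 - sqrt (1 - \<gamma>)) / 2)) powr (1 / b)}"

end

theory Submission imports Defs begin

text \<open>
  After the substitution \<open>Y = (X / \<alpha>) powr \<beta>\<close> the observations are standard exponential and
  \<open>Y\<close>-records are images of \<open>X\<close>-records. Let \<open>S k\<close> be the \<open>k\<close>-th record of \<open>Y\<close> and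
  \<open>L k = (\<Sum>i=0..k. ln (S k / S i)) = (\<Sum>i<k. (i + 1) * ln (S (i + 1) / S i))\<close>. The pair \<open>(S, L)\<close>
  is a Markov chain, and by induction \<open>S k\<close> and \<open>L k\<close> are independent and Gamma distributed
  with shapes \<open>k + 1\<close> and \<open>k\<close>: in one step from \<open>s\<close> to \<open>t\<close>, the variable
  \<open>(k + 1) * ln (t / s)\<close> is standard exponential and independent of \<open>t\<close>. The two conditions defining
  the confidence region confine the chi-square pivots \<open>2 * L n\<close> and \<open>2 * S n\<close> to intervals of
  probability \<open>sqrt (1 - \<gamma>)\<close> each.
\<close>

section \<open>Erlang laws\<close>

text \<open>The Gamma law of shape \<open>k\<close> and rate 1; the index is shifted because
  \<open>erlang_density k\<close> has shape \<open>k + 1\<close>. Shape 0 is the point mass at 0, so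
  that record and accumulated logarithms have a product law already at the initial record.\<close>

definition erlang_law :: "nat \<Rightarrow> real measure" where
  "erlang_law k = (if k = 0 then return borel 0 else density lborel (erlang_density (k - 1) 1))"

lemma sets_erlang_law [simp, measurable_cong]: "sets (erlang_law k) = sets borel"
  by (simp add: erlang_law_def)

lemma space_erlang_law [simp]: "space (erlang_law k) = UNIV"
  by (simp add: erlang_law_def)

lemma prob_space_erlang_law: "prob_space (erlang_law k)"
  by (simp add: erlang_law_def prob_space_return prob_space_erlang_density)

lemma erlang_law_Suc: "erlang_law (Suc k) = density lborel (erlang_density k 1)"
  by (simp add: erlang_law_def)

lemma nn_integral_erlang_law_Suc:
  assumes [measurable]: "f \<in> borel_measurable borel"
  shows "(\<integral>\<^sup>+x. f x \<partial>erlang_law (Suc k)) = (\<integral>\<^sup>+x. ennreal (erlang_density k 1 x) * f x \<partial>lborel)"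
  by (simp add: erlang_law_Suc nn_integral_density)

text \<open>Shape 0 has no Lebesgue density; there the point mass at 0 is neutral for convolution.
  For positive shapes the convolution formula for Erlang densities applies.\<close>

lemma erlang_law_convolution_1: "erlang_law k \<star> erlang_law (Suc 0) = erlang_law (Suc k)"
proof (cases k)
  case 0
  have "erlang_law 0 \<star> erlang_law (Suc 0) = erlang_law (Suc 0)"
  proof (rule measure_eqI)
    fix A assume "A \<in> sets (erlang_law 0 \<star> erlang_law (Suc 0))"
    then have [measurable]: "A \<in> sets borel" by simp
    have fin: "finite_measure (erlang_law j)" for j
      using prob_space_erlang_law[of j] by (simp add: prob_space_def)
    have "emeasure (erlang_law 0 \<star> erlang_law (Suc 0)) A = (\<integral>\<^sup>+x. \<integral>\<^sup>+y. indicator A (x + y) \<partial>erlang_law (Suc 0) \<partial>erlang_law 0)"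
      by (rule convolution_emeasure') (auto simp: fin)
    also have "\<dots> = (\<integral>\<^sup>+y. indicator A (0 + y) \<partial>erlang_law (Suc 0))"
    proof -
      interpret sigma_finite_measure "erlang_law (Suc 0)"
        by (rule prob_space_imp_sigma_finite[OF prob_space_erlang_law])
      have "erlang_law 0 = return borel 0" by (simp add: erlang_law_def)
      moreover have "(\<lambda>x. \<integral>\<^sup>+y. indicator A (x + y) \<partial>erlang_law (Suc 0)) \<in> borel_measurable borel"
        by measurable
      ultimately show ?thesis
        by (simp only: nn_integral_return space_borel UNIV_I)
    qed
    finally show "emeasure (erlang_law 0 \<star> erlang_law (Suc 0)) A = emeasure (erlang_law (Suc 0)) A"
      by simp
  qed simp
  then show ?thesis using 0 by simp
next
  case (Suc j)
  have "density lborel (erlang_density j 1) \<star> density lborel (erlang_density 0 1) =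
    density lborel (erlang_density (Suc j) 1)"
    by (subst convolution_density)
      (auto simp: convolution_erlang_density intro!: prob_space.finite_measure prob_space_erlang_density)
  then show ?thesis using Suc by (simp add: erlang_law_def)
qed

lemma nn_integral_erlang_law_convolution:
  assumes [measurable]: "f \<in> borel_measurable borel"
  shows "(\<integral>\<^sup>+x. \<integral>\<^sup>+w. f (x + w) \<partial>erlang_law (Suc 0) \<partial>erlang_law k) = (\<integral>\<^sup>+x. f x \<partial>erlang_law (Suc k))"
  unfolding erlang_law_convolution_1[of k, symmetric]
  by (subst nn_integral_convolution) (auto intro!: prob_space.finite_measure prob_space_erlang_law)

text \<open>If \<open>r / t\<close> is distributed as the maximum of \<open>m + 1\<close> uniform variables, then
  \<open>(m + 1) * ln (t / r)\<close> is standard exponential.\<close>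

lemma nn_integral_power_log:
  fixes g :: "real \<Rightarrow> ennreal"
  assumes t: "0 < t" and [measurable]: "g \<in> borel_measurable borel"
  shows "(\<integral>\<^sup>+r. ennreal (indicator {0..t} r * r ^ m / fact m) * g (real (Suc m) * ln (t / r)) \<partial>lborel) =
    ennreal (t ^ Suc m / fact (Suc m)) * (\<integral>\<^sup>+w. g w \<partial>erlang_law (Suc 0))"
proof -
  \<comment> \<open>The weight \<open>r ^ m / fact m\<close> on \<open>{0..t}\<close>, divided by
    its total mass \<open>t ^ Suc m / fact (Suc m)\<close>. Its antiderivative is
    \<open>(r / t) ^ Suc m\<close>.\<close>
  define d where "d = (\<lambda>r::real. real (Suc m) * r ^ m / t ^ Suc m)"
  define D where "D = density lborel (\<lambda>r. ennreal (d r) * indicator {0..t} r)"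
  have [measurable]: "d \<in> borel_measurable borel" by (simp add: d_def)
  have setsD [simp, measurable_cong]: "sets D = sets borel" and spaceD [simp]: "space D = UNIV"
    by (simp_all add: D_def)
  have mass: "(\<integral>\<^sup>+r. ennreal (d r) * indicator {c..t} r \<partial>lborel) = 1 - ennreal ((c / t) ^ Suc m)"
    if "0 \<le> c" "c \<le> t" for c
  proof -
    have "(\<integral>\<^sup>+r. ennreal (d r) * indicator {c..t} r \<partial>lborel) = ennreal ((t / t) ^ Suc m - (c / t) ^ Suc m)"
      using that t unfolding d_def
      by (intro nn_integral_FTC_Icc)
        (auto intro!: derivative_eq_intros simp: field_simps simp del: power_Suc)
    also have "\<dots> = 1 - ennreal ((c / t) ^ Suc m)"
      using that t by (simp add: ennreal_minus[symmetric] del: power_Suc flip: ennreal_1)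
    finally show ?thesis .
  qed
  have "distributed D lborel (\<lambda>r. real (Suc m) * ln (t / r)) (exponential_density 1)"
  proof (rule exponential_distributedI)
    fix a :: real assume a: "0 \<le> a"
    \<comment> \<open>The solution of \<open>real (Suc m) * ln (t / c) = a\<close>; the event in
      question is then \<open>{c..t}\<close>, of mass \<open>1 - exp (- a)\<close>.\<close>
    define c where "c = t * exp (- a / real (Suc m))"
    have c: "0 < c" "c \<le> t"
      using t a by (auto simp: c_def mult_le_cancel_left1)
    have *: "real (Suc m) * ln (t / r) \<le> a \<longleftrightarrow> c \<le> r" if "0 < r" for r
    proof -
      have "real (Suc m) * ln (t / r) \<le> a \<longleftrightarrow> ln (t / r) \<le> a / real (Suc m)"
        by (simp add: field_simps)
      also have "\<dots> \<longleftrightarrow> t / r \<le> exp (a / real (Suc m))"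
        using t that by (subst ln_le_cancel_iff[symmetric]) auto
      also have "\<dots> \<longleftrightarrow> c \<le> r"
        using that by (simp add: c_def exp_minus field_simps)
      finally show ?thesis .
    qed
    have "emeasure D {r \<in> space D. real (Suc m) * ln (t / r) \<le> a} =
      (\<integral>\<^sup>+r. ennreal (d r) * indicator {0..t} r * indicator {r. real (Suc m) * ln (t / r) \<le> a} r \<partial>lborel)"
      unfolding D_def by (subst emeasure_density) auto
    also have "\<dots> = (\<integral>\<^sup>+r. ennreal (d r) * indicator {c..t} r \<partial>lborel)"
    proof (intro nn_integral_cong_AE)
      \<comment> \<open>The null point 0 is left out: \<open>t / 0\<close> is a default value and
        says nothing about the order of \<open>r\<close> and \<open>c\<close>.\<close>
      show "AE r in lborel. ennreal (d r) * indicator {0..t} r * indicator {r. real (Suc m) * ln (t / r) \<le> a} r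
        = ennreal (d r) * indicator {c..t} r"
        using AE_lborel_singleton[of 0]
      proof eventually_elim
        case (elim r)
        then show ?case
          using *[of r] c by (cases "0 < r") (auto simp: indicator_def)
      qed
    qed
    also have "\<dots> = 1 - ennreal ((c / t) ^ Suc m)"
      using c by (intro mass) auto
    also have "(c / t) ^ Suc m = exp (- a * 1)"
      using t by (simp add: c_def exp_of_nat_mult[symmetric] del: power_Suc of_nat_Suc)
    finally show "emeasure D {r \<in> space D. real (Suc m) * ln (t / r) \<le> a} = 1 - ennreal (exp (- a * 1))" .
  qed auto
  then have distr: "distr D lborel (\<lambda>r. real (Suc m) * ln (t / r)) = erlang_law (Suc 0)"
    by (simp add: distributed_def erlang_law_def)
  have "(\<integral>\<^sup>+w. g w \<partial>erlang_law (Suc 0)) = (\<integral>\<^sup>+r. g (real (Suc m) * ln (t / r)) \<partial>D)"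
    unfolding distr[symmetric] by (subst nn_integral_distr) auto
  also have "\<dots> = (\<integral>\<^sup>+r. ennreal (d r) * indicator {0..t} r * g (real (Suc m) * ln (t / r)) \<partial>lborel)"
    unfolding D_def by (subst nn_integral_density) auto
  finally have "ennreal (t ^ Suc m / fact (Suc m)) * (\<integral>\<^sup>+w. g w \<partial>erlang_law (Suc 0)) =
    (\<integral>\<^sup>+r. ennreal (t ^ Suc m / fact (Suc m)) * (ennreal (d r) * indicator {0..t} r * g (real (Suc m) * ln (t / r))) \<partial>lborel)"
    by (elim ssubst) (subst nn_integral_cmult; simp)
  also have "\<dots> = (\<integral>\<^sup>+r. ennreal (indicator {0..t} r * r ^ m / fact m) * g (real (Suc m) * ln (t / r)) \<partial>lborel)"
  proof (intro nn_integral_cong)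
    fix r
    have "ennreal (t ^ Suc m / fact (Suc m)) * ennreal (d r) = ennreal (r ^ m / fact m)" if "0 \<le> r"
      using t that by (subst ennreal_mult[symmetric]) (auto simp: d_def divide_simps)
    then show "ennreal (t ^ Suc m / fact (Suc m)) * (ennreal (d r) * indicator {0..t} r * g (real (Suc m) * ln (t / r)))
      = ennreal (indicator {0..t} r * r ^ m / fact m) * g (real (Suc m) * ln (t / r))"
      by (auto simp: indicator_def mult.assoc[symmetric] simp del: fact_Suc power_Suc of_nat_Suc)
  qed
  finally show ?thesis ..
qed

text \<open>By memorylessness the record following \<open>r\<close> has density
  \<open>exp (r - t)\<close> on \<open>t > r\<close>. Against the Erlang density of \<open>r\<close>
  the factors \<open>exp (- r)\<close> and \<open>exp r\<close> cancel, leaving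
  \<open>exp (- t) * r ^ m / fact m\<close> on \<open>0 \<le> r < t\<close>. Integrating over
  \<open>r\<close> first, for fixed \<open>t\<close>, turns the weighted log ratio into an
  exponential \<open>w\<close> independent of \<open>t\<close>, and the mass
  \<open>t ^ Suc m / fact (Suc m)\<close> raises the shape to \<open>m + 2\<close>.\<close>

lemma nn_integral_record_step:
  fixes g :: "real \<times> real \<Rightarrow> ennreal"
  assumes [measurable]: "g \<in> borel_measurable (borel \<Otimes>\<^sub>M borel)"
  shows "(\<integral>\<^sup>+r. ennreal (exp r) * (\<integral>\<^sup>+t. (if r < t then g (t, real (Suc m) * ln (t / r)) else 0) \<partial>erlang_law (Suc 0)) \<partial>erlang_law (Suc m)) =
    (\<integral>\<^sup>+t. \<integral>\<^sup>+w. g (t, w) \<partial>erlang_law (Suc 0) \<partial>erlang_law (Suc (Suc m)))" (is "?L = ?R")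
proof -
  interpret prob_space "erlang_law (Suc 0)" by (rule prob_space_erlang_law)
  have "?L = (\<integral>\<^sup>+r. \<integral>\<^sup>+t. ennreal (erlang_density m 1 r) * ennreal (exp r) * (ennreal (erlang_density 0 1 t) *
      (if r < t then g (t, real (Suc m) * ln (t / r)) else 0)) \<partial>lborel \<partial>lborel)"
  proof -
    have "?L = (\<integral>\<^sup>+r. ennreal (erlang_density m 1 r) * (ennreal (exp r) *
        (\<integral>\<^sup>+t. (if r < t then g (t, real (Suc m) * ln (t / r)) else 0) \<partial>erlang_law (Suc 0))) \<partial>lborel)"
      by (intro nn_integral_erlang_law_Suc) measurable
    also have "\<dots> = (\<integral>\<^sup>+r. ennreal (erlang_density m 1 r) * (ennreal (exp r) *
        (\<integral>\<^sup>+t. ennreal (erlang_density 0 1 t) *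
          (if r < t then g (t, real (Suc m) * ln (t / r)) else 0) \<partial>lborel)) \<partial>lborel)"
      by (subst nn_integral_erlang_law_Suc) auto
    finally show ?thesis
      by (simp add: nn_integral_cmult mult.assoc del: of_nat_Suc)
  qed
  also have "\<dots> = (\<integral>\<^sup>+t. \<integral>\<^sup>+r. ennreal (erlang_density m 1 r) * ennreal (exp r) * (ennreal (erlang_density 0 1 t) *
      (if r < t then g (t, real (Suc m) * ln (t / r)) else 0)) \<partial>lborel \<partial>lborel)"
    by (rule lborel_pair.Fubini') measurable
  also have "\<dots> = (\<integral>\<^sup>+t. ennreal (erlang_density (Suc m) 1 t) * (\<integral>\<^sup>+w. g (t, w) \<partial>erlang_law (Suc 0)) \<partial>lborel)"
  proof (intro nn_integral_cong_AE)
    show "AE t in lborel. (\<integral>\<^sup>+r. ennreal (erlang_density m 1 r) * ennreal (exp r) * (ennreal (erlang_density 0 1 t) *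
      (if r < t then g (t, real (Suc m) * ln (t / r)) else 0)) \<partial>lborel) =
      ennreal (erlang_density (Suc m) 1 t) * (\<integral>\<^sup>+w. g (t, w) \<partial>erlang_law (Suc 0))"
      using AE_lborel_singleton[of 0]
    proof eventually_elim
      case (elim t)
      show ?case
      proof (cases "0 < t")
        case False
        then have "t < 0" using elim by simp
        then show ?thesis by (simp add: erlang_density_def)
      next
        case True
        have "(\<integral>\<^sup>+r. ennreal (erlang_density m 1 r) * ennreal (exp r) * (ennreal (erlang_density 0 1 t) *
          (if r < t then g (t, real (Suc m) * ln (t / r)) else 0)) \<partial>lborel) =
          (\<integral>\<^sup>+r. ennreal (exp (- t)) * (ennreal (indicator {0..t} r * r ^ m / fact m) * g (t, real (Suc m) * ln (t / r))) \<partial>lborel)"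
        proof (intro nn_integral_cong_AE)
          \<comment> \<open>The sides can differ only at \<open>r = t\<close>, which lies in the
            closed interval but violates the strict inequality.\<close>
          show "AE r in lborel. ennreal (erlang_density m 1 r) * ennreal (exp r) * (ennreal (erlang_density 0 1 t) *
            (if r < t then g (t, real (Suc m) * ln (t / r)) else 0)) =
            ennreal (exp (- t)) * (ennreal (indicator {0..t} r * r ^ m / fact m) * g (t, real (Suc m) * ln (t / r)))"
            using AE_lborel_singleton[of t]
          proof eventually_elim
            case (elim r)
            consider "r < 0" | "0 \<le> r" "r < t" | "r > t" using elim by linarith
            then show ?case
            proof cases
              case 2
              have e: "ennreal (erlang_density m 1 r) * ennreal (exp r) = ennreal (r ^ m / fact m)"
                using 2 by (subst ennreal_mult[symmetric]) (auto simp: erlang_density_def exp_minus field_simps)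
              show ?thesis
                unfolding e using 2 True by (simp add: erlang_density_def mult_ac)
            qed (auto simp: erlang_density_def)
          qed
        qed
        also have "\<dots> = ennreal (exp (- t)) * (ennreal (t ^ Suc m / fact (Suc m)) * (\<integral>\<^sup>+w. g (t, w) \<partial>erlang_law (Suc 0)))"
          by (subst nn_integral_cmult, measurable, subst nn_integral_power_log[OF True]) auto
        also have "\<dots> = ennreal (erlang_density (Suc m) 1 t) * (\<integral>\<^sup>+w. g (t, w) \<partial>erlang_law (Suc 0))"
          using True unfolding mult.assoc[symmetric]
          by (subst ennreal_mult[symmetric]) (auto simp: erlang_density_def mult_ac simp del: power_Suc)
        finally show ?thesis .
      qed
    qed
  qed
  also have "\<dots> = ?R"
    by (intro nn_integral_erlang_law_Suc[symmetric]) measurable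
  finally show ?thesis .
qed

section \<open>Record values of a sequence\<close>

text \<open>Records as a functional of one deterministic path, so that their law can be computed on
  sequence space.\<close>

definition records :: "(nat \<Rightarrow> real) \<Rightarrow> nat \<Rightarrow> real" where
  "records x k = record_value (\<lambda>j y. y j) k x"

lemma records_0 [simp]: "records x 0 = x 0"
  by (simp add: records_def record_value_def)

lemma records_Suc: "records x (Suc k) = x (LEAST j. records x k < x j)"
  by (simp add: records_def record_value_def)

lemma record_value_eq_records: "record_value X k \<omega> = records (\<lambda>j. X j \<omega>) k"
proof (induction k)
  case (Suc k)
  then show ?case
    by (simp add: records_Suc) (simp add: record_value_def)
qed (simp add: record_value_def)

text \<open>Record times depend only on the order of the observations. Even when no further record
  exists, both sides apply \<open>LEAST\<close> to the same predicate.\<close>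

lemma records_strict_mono_comp:
  assumes "strict_mono h"
  shows "records (\<lambda>j. h (x j)) k = h (records x k)"
proof (induction k)
  case (Suc k)
  then show ?case using assms by (simp add: records_Suc strict_mono_less)
qed simp

lemma records_less_Suc:
  assumes "\<And>r. \<exists>j. r < x j"
  shows "records x k < records x (Suc k)"
  unfolding records_Suc by (rule LeastI_ex) (rule assms)

lemma records_mono:
  assumes "\<And>r. \<exists>j. r < x j" "i \<le> k"
  shows "records x i \<le> records x k"
  using lift_Suc_mono_le[of "records x", OF less_imp_le[OF records_less_Suc[OF assms(1)]] assms(2)] .

text \<open>The observation \<open>t\<close> beats \<open>r\<close> at once and so is the next
  record. From then on every record is at least \<open>r\<close>, the entry at index 0 is never
  selected again, and deleting it only shifts indices.\<close>

lemma records_case_nat_less: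
  assumes x: "\<And>r. \<exists>j. r < x j" and "r < t"
  shows "records (case_nat r (case_nat t x)) (Suc k) = records (case_nat t x) k"
proof -
  define y where "y = case_nat t x"
  have y: "\<exists>j. a < y j" for a
    using x[of a] by (auto simp: y_def intro: exI[of _ "Suc _"])
  have Least: "(LEAST j. a < case_nat r y j) = Suc (LEAST j. a < y j)" if "r \<le> a" for a
  proof -
    obtain i where "a < y i" using y by blast
    then show ?thesis using that by (subst Least_Suc[of _ "Suc i"]) auto
  qed
  have "records (case_nat r y) (Suc k) = records y k"
  proof (induction k)
    case 0
    have "(LEAST j. r < y j) = 0"
      using \<open>r < t\<close> by (intro Least_eq_0) (simp add: y_def)
    then show ?case by (simp add: records_Suc Least)
  next
    case (Suc k)
    have "r \<le> records y k"
      using records_mono[OF y, of 0 k] \<open>r < t\<close> by (simp add: y_def)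
    then have "records (case_nat r y) (Suc (Suc k)) = y (LEAST j. records y k < y j)"
      by (subst records_Suc) (simp add: Suc Least)
    then show ?case by (simp add: records_Suc)
  qed
  then show ?thesis by (simp add: y_def)
qed

text \<open>An observation that does not exceed the current record is never selected later either,
  so deleting it only shifts indices.\<close>

lemma records_case_nat_ge:
  assumes x: "\<And>r. \<exists>j. r < x j" and "t \<le> r"
  shows "records (case_nat r (case_nat t x)) k = records (case_nat r x) k"
proof (induction k)
  case (Suc k)
  define v where "v = records (case_nat r x) k"
  have "\<exists>j. a < case_nat r x j" for a
    using x[of a] by (auto intro: exI[of _ "Suc _"])
  then have v: "r \<le> v"
    using records_mono[of "case_nat r x" 0 k] by (simp add: v_def)
  obtain i where i: "v < x i" using x by blast
  have "(LEAST j. v < case_nat r x j) = Suc (LEAST j. v < x j)"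
    using v i by (subst Least_Suc[of _ "Suc i"]) auto
  \<comment> \<open>Both leading entries \<open>r\<close> and \<open>t\<close> are at most
    \<open>v\<close>, so the search skips two indices here and one index above.\<close>
  moreover have "(LEAST j. v < case_nat r (case_nat t x) j) = Suc (Suc (LEAST j. v < x j))"
    using v i \<open>t \<le> r\<close> by (subst Least_Suc[of _ "Suc (Suc i)"], simp, simp, simp, subst Least_Suc[of _ "Suc i"]) auto
  ultimately show ?case
    using Suc by (simp add: records_Suc v_def[symmetric])
qed simp

lemma measurable_records [measurable]:
  "(\<lambda>x. records x k) \<in> borel_measurable (PiM UNIV (\<lambda>_. borel))"
proof (induction k)
  case (Suc k)
  note [measurable] = Suc
  have "(\<lambda>x. x (LEAST j. records x k < x j)) \<in> borel_measurable (PiM UNIV (\<lambda>_. borel))"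
    by (rule measurable_compose_countable[where g="\<lambda>x. LEAST j. records x k < x j"]) measurable
  then show ?case by (simp add: records_Suc)
qed simp

text \<open>The offset \<open>m\<close> counts the records passed before the path starts, so that
  the weights continue where an earlier segment stopped. For \<open>m = 0\<close> this is
  \<open>L k\<close> of the overview, in the form that is additive along the path.\<close>

definition log_increments :: "(nat \<Rightarrow> real) \<Rightarrow> nat \<Rightarrow> nat \<Rightarrow> real" where
  "log_increments x m k = (\<Sum>i<k. real (Suc (m + i)) * ln (records x (Suc i) / records x i))"

lemma measurable_log_increments [measurable]:
  "(\<lambda>x. log_increments x m k) \<in> borel_measurable (PiM UNIV (\<lambda>_. borel))"
  unfolding log_increments_def by measurable

text \<open>Passing from record \<open>k\<close> to record \<open>k + 1\<close> raises each of the
  \<open>k + 1\<close> logarithms by the same amount, which is where the weight comes from; the new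
  summand is \<open>ln 1 = 0\<close>.\<close>

lemma log_increments_eq:
  assumes "\<And>r. \<exists>j. r < x j" "0 < x 0"
  shows "log_increments x 0 k = (\<Sum>i=0..k. ln (records x k / records x i))"
proof -
  have pos: "0 < records x i" for i
    using records_mono[OF assms(1), of 0 i] assms(2) by simp
  show ?thesis
  proof (induction k)
    case 0
    show ?case using pos[of 0] by (simp add: log_increments_def)
  next
    case (Suc k)
    have "log_increments x 0 (Suc k) = log_increments x 0 k + real (Suc k) * ln (records x (Suc k) / records x k)"
      by (simp add: log_increments_def)
    also have "\<dots> = (\<Sum>i=0..k. ln (records x k / records x i) + ln (records x (Suc k) / records x k))"
      unfolding Suc by (simp add: sum.distrib)
    also have "\<dots> = (\<Sum>i=0..k. ln (records x (Suc k) / records x i))"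
      using pos[THEN less_imp_neq[THEN not_sym]] pos by (intro sum.cong) (auto simp: ln_div)
    finally show ?case using pos[of "Suc k"] by simp
  qed
qed

lemma log_increments_case_nat_less:
  assumes x: "\<And>r. \<exists>j. r < x j" and "r < t"
  shows "log_increments (case_nat r (case_nat t x)) m (Suc k) =
    real (Suc m) * ln (t / r) + log_increments (case_nat t x) (Suc m) k"
  unfolding log_increments_def
  by (subst sum.lessThan_Suc_shift) (simp add: records_case_nat_less[OF assms])

section \<open>Records of an exponential sequence\<close>

abbreviation exp_seq :: "(nat \<Rightarrow> real) measure" where
  "exp_seq \<equiv> PiM UNIV (\<lambda>_. erlang_law (Suc 0))"

interpretation erlang: real_distribution "erlang_law k" for k
  by (intro real_distribution.intro real_distribution_axioms.intro prob_space_erlang_law sets_erlang_law)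

interpretation exp_seq: sequence_space "erlang_law (Suc 0)"
  by standard

lemma sets_exp_seq [measurable_cong]: "sets exp_seq = sets (PiM UNIV (\<lambda>_. borel))"
  by (intro sets_PiM_cong) auto

text \<open>The first observation is independent of the remaining sequence, which has the law of the
  whole.\<close>

lemma nn_integral_exp_seq:
  assumes [measurable]: "f \<in> borel_measurable (PiM UNIV (\<lambda>_. borel))"
  shows "(\<integral>\<^sup>+x. f x \<partial>exp_seq) = (\<integral>\<^sup>+t. \<integral>\<^sup>+x. f (case_nat t x) \<partial>exp_seq \<partial>erlang_law (Suc 0))"
proof -
  have "(\<integral>\<^sup>+x. f x \<partial>exp_seq) =
    (\<integral>\<^sup>+x. f x \<partial>distr (erlang_law (Suc 0) \<Otimes>\<^sub>M exp_seq) exp_seq (\<lambda>(s, \<omega>). case_nat s \<omega>))"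
    by (simp only: exp_seq.PiM_iter)
  also have "\<dots> = (\<integral>\<^sup>+p. f (case_nat (fst p) (snd p)) \<partial>(erlang_law (Suc 0) \<Otimes>\<^sub>M exp_seq))"
    by (subst nn_integral_distr) (auto simp: case_prod_beta')
  also have "\<dots> = (\<integral>\<^sup>+t. \<integral>\<^sup>+x. f (case_nat t x) \<partial>exp_seq \<partial>erlang_law (Suc 0))"
    by (subst exp_seq.P.nn_integral_fst[symmetric]) auto
  finally show ?thesis .
qed

lemma erlang_law_1_greaterThan:
  assumes "0 \<le> r"
  shows "emeasure (erlang_law (Suc 0)) {r<..} = ennreal (exp (- r))"
    and "emeasure (erlang_law (Suc 0)) {..r} = ennreal (1 - exp (- r))"
proof -
  show le: "emeasure (erlang_law (Suc 0)) {..r} = ennreal (1 - exp (- r))"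
    using assms emeasure_erlang_density[of 1 0 r] by (simp add: erlang_law_def erlang_CDF_def)
  have "emeasure (erlang_law (Suc 0)) (space (erlang_law (Suc 0)) - {..r}) = 1 - ennreal (1 - exp (- r))"
    by (subst emeasure_compl) (auto simp: le erlang.emeasure_space_1[where k="Suc 0", simplified])
  also have "space (erlang_law (Suc 0)) - {..r} = {r<..}" by auto
  also have "1 - ennreal (1 - exp (- r)) = ennreal (exp (- r))"
    using assms by (subst ennreal_1[symmetric], subst ennreal_minus) auto
  finally show "emeasure (erlang_law (Suc 0)) {r<..} = ennreal (exp (- r))" .
qed

text \<open>All observations stay below \<open>N\<close> with probability
  \<open>lim (1 - exp (- N)) ^ n = 0\<close>. Countably many \<open>N\<close> suffice, so almost
  surely every \<open>LEAST\<close> in the record times has a witness.\<close>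

lemma AE_exp_seq_unbounded: "AE x in exp_seq. \<forall>r. \<exists>j. r < x j"
proof -
  have "AE x in exp_seq. \<exists>j. real N < x j" for N
  proof -
    let ?B = "Pi UNIV (\<lambda>_::nat. {..real N})"
    have "(\<lambda>n. \<Prod>i\<le>n. measure (erlang_law (Suc 0)) {..real N}) \<longlonglongrightarrow> measure exp_seq ?B"
      by (rule exp_seq.measure_PiM_countable) auto
    moreover have "measure (erlang_law (Suc 0)) {..real N} = 1 - exp (- real N)"
      using erlang_law_1_greaterThan(2)[of "real N"] by (simp add: measure_def)
    ultimately have "(\<lambda>n. (1 - exp (- real N)) ^ Suc n) \<longlonglongrightarrow> measure exp_seq ?B"
      by simp
    moreover have "(\<lambda>n. (1 - exp (- real N)) ^ Suc n) \<longlonglongrightarrow> 0"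
      by (intro LIMSEQ_Suc LIMSEQ_realpow_zero) auto
    ultimately have "measure exp_seq ?B = 0"
      by (rule LIMSEQ_unique)
    moreover have B: "?B \<in> sets exp_seq"
      by (rule exp_seq.infprod_in_sets) auto
    ultimately have "?B \<in> null_sets exp_seq"
      by (simp add: null_sets_def exp_seq.P.emeasure_eq_measure)
    then show ?thesis
      by (rule AE_I') (auto simp: Pi_iff not_less)
  qed
  then have "AE x in exp_seq. \<forall>N. \<exists>j. real N < x j"
    by (simp add: AE_all_countable)
  then show ?thesis
  proof eventually_elim
    case (elim x)
    show ?case
    proof
      fix r :: real
      obtain N where "r \<le> real N" using real_arch_simple by blast
      then show "\<exists>j. r < x j" using elim[rule_format, of N] by (auto intro: le_less_trans)
    qed
  qed
qed

text \<open>The law of the pair (record value, accumulated weighted log increments) after \<open>k\<close> further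
  records, given that the \<open>m\<close>-th record is \<open>r\<close> and \<open>l\<close> has been accumulated so far.\<close>

definition record_prob :: "(real \<times> real) set \<Rightarrow> nat \<Rightarrow> nat \<Rightarrow> real \<Rightarrow> real \<Rightarrow> ennreal" where
  "record_prob A m k r l =
    (\<integral>\<^sup>+x. indicator A (records (case_nat r x) k, l + log_increments (case_nat r x) m k) \<partial>exp_seq)"

lemma measurable_record_prob [measurable (raw)]:
  assumes [measurable]: "A \<in> sets (borel \<Otimes>\<^sub>M borel)" "f \<in> borel_measurable N" "g \<in> borel_measurable N"
  shows "(\<lambda>y. record_prob A m k (f y) (g y)) \<in> borel_measurable N"
  unfolding record_prob_def by measurable

lemma record_prob_le_1: "record_prob A m k r l \<le> 1"
proof -
  have "record_prob A m k r l \<le> (\<integral>\<^sup>+x. 1 \<partial>exp_seq)"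
    unfolding record_prob_def by (intro nn_integral_mono) (auto simp: indicator_def)
  then show ?thesis by (simp add: exp_seq.P.emeasure_space_1)
qed

lemma record_prob_0: "record_prob A m 0 r l = indicator A (r, l)"
  by (simp add: record_prob_def log_increments_def exp_seq.P.emeasure_space_1)

text \<open>Conditioning on the first observation \<open>t\<close>: it is either the next record, or it is discarded
  and the situation is unchanged. This yields a linear equation for \<^term>\<open>record_prob A m (Suc k) r l\<close>.\<close>

lemma record_prob_Suc:
  assumes [measurable]: "A \<in> sets (borel \<Otimes>\<^sub>M borel)" and r: "0 \<le> r"
  shows "record_prob A m (Suc k) r l = ennreal (exp r) *
    (\<integral>\<^sup>+t. (if r < t then record_prob A (Suc m) k t (l + real (Suc m) * ln (t / r)) else 0) \<partial>erlang_law (Suc 0))"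
    (is "?J = _ * ?I")
proof -
  let ?f = "\<lambda>x. indicator A (records (case_nat r x) (Suc k), l + log_increments (case_nat r x) m (Suc k)) :: ennreal"
  have "?J = (\<integral>\<^sup>+t. \<integral>\<^sup>+x. ?f (case_nat t x) \<partial>exp_seq \<partial>erlang_law (Suc 0))"
    unfolding record_prob_def by (rule nn_integral_exp_seq) measurable
  also have "\<dots> = (\<integral>\<^sup>+t. (if r < t then record_prob A (Suc m) k t (l + real (Suc m) * ln (t / r)) else 0) +
      ?J * indicator {..r} t \<partial>erlang_law (Suc 0))"
  proof (rule nn_integral_cong)
    fix t
    show "(\<integral>\<^sup>+x. ?f (case_nat t x) \<partial>exp_seq) =
      (if r < t then record_prob A (Suc m) k t (l + real (Suc m) * ln (t / r)) else 0) + ?J * indicator {..r} t"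
    proof (cases "r < t")
      case True
      have "(\<integral>\<^sup>+x. ?f (case_nat t x) \<partial>exp_seq) = record_prob A (Suc m) k t (l + real (Suc m) * ln (t / r))"
        unfolding record_prob_def
      proof (rule nn_integral_cong_AE)
        show "AE x in exp_seq. ?f (case_nat t x) = indicator A (records (case_nat t x) k,
          l + real (Suc m) * ln (t / r) + log_increments (case_nat t x) (Suc m) k)"
          using AE_exp_seq_unbounded
        proof eventually_elim
          case (elim x)
          then have x: "\<And>a. \<exists>j. a < x j" by blast
          show ?case
            by (simp only: records_case_nat_less[OF x True] log_increments_case_nat_less[OF x True] add.assoc)
        qed
      qed
      then show ?thesis using True by simp
    next
      case False
      have "(\<integral>\<^sup>+x. ?f (case_nat t x) \<partial>exp_seq) = ?J"
        unfolding record_prob_def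
      proof (rule nn_integral_cong_AE)
        show "AE x in exp_seq. ?f (case_nat t x) = ?f x"
          using AE_exp_seq_unbounded
        proof eventually_elim
          case (elim x)
          then have x: "\<And>a. \<exists>j. a < x j" by blast
          show ?case
            using False by (simp only: records_case_nat_ge[OF x] log_increments_def not_less)
        qed
      qed
      then show ?thesis using False by simp
    qed
  qed
  also have "\<dots> = ?I + ?J * ennreal (1 - exp (- r))"
    by (subst nn_integral_add) (auto simp: nn_integral_cmult_indicator erlang_law_1_greaterThan[OF r, simplified])
  finally have eq: "?J = ?I + ?J * ennreal (1 - exp (- r))" .
  \<comment> \<open>Both quantities are finite, being bounded by a probability, so the equation can
    be solved over the reals; the coefficient of \<open>?J\<close> is the probability
    \<open>exp (- r)\<close> of exceeding \<open>r\<close>.\<close>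
  obtain j where j: "?J = ennreal j" "0 \<le> j"
    using record_prob_le_1[of A m "Suc k" r l] by (cases "?J") (auto simp: top_unique)
  have "?I \<le> ?J" by (subst eq) simp
  then obtain i where i: "?I = ennreal i" "0 \<le> i"
    using j by (cases "?I") (auto simp: top_unique)
  have "j = i + j * (1 - exp (- r))"
    using eq i j r unfolding i j
    by (simp add: ennreal_mult[symmetric] ennreal_plus[symmetric] del: ennreal_plus)
  then have "j * exp (- r) = i"
    by (simp add: algebra_simps)
  then have "j = exp r * i"
    by (auto simp: exp_minus)
  then show ?thesis
    using i j by (simp add: ennreal_mult)
qed

text \<open>Starting the chain at record number \<open>m\<close> from the product law of shapes
  \<open>m + 1\<close> and \<open>m\<close>, \<open>k\<close> further steps lead to the product law
  for \<open>m + k\<close>. The induction performs the first step and uses the hypothesis at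
  \<open>Suc m\<close>, so \<open>m\<close> must vary.\<close>

lemma nn_integral_record_prob:
  assumes [measurable]: "A \<in> sets (borel \<Otimes>\<^sub>M borel)"
  shows "(\<integral>\<^sup>+r. \<integral>\<^sup>+l. record_prob A m k r l \<partial>erlang_law m \<partial>erlang_law (Suc m)) =
    (\<integral>\<^sup>+r. \<integral>\<^sup>+l. indicator A (r, l) \<partial>erlang_law (m + k) \<partial>erlang_law (Suc (m + k)))"
proof (induction k arbitrary: m)
  case 0
  show ?case by (simp add: record_prob_0)
next
  case (Suc k)
  \<comment> \<open>The accumulated \<open>l\<close> is averaged out first, so that the one-step
    identity sees only the record \<open>t\<close> and the new increment \<open>w\<close>.\<close>
  define g where "g = (\<lambda>(t, w). \<integral>\<^sup>+l. record_prob A (Suc m) k t (l + w) \<partial>erlang_law m)"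
  have [measurable]: "g \<in> borel_measurable (borel \<Otimes>\<^sub>M borel)"
    unfolding g_def case_prod_beta' by measurable
  have "AE r in erlang_law (Suc m). 0 \<le> r"
    unfolding erlang_law_Suc by (subst AE_density) (auto simp: erlang_density_def)
  then have "(\<integral>\<^sup>+r. \<integral>\<^sup>+l. record_prob A m (Suc k) r l \<partial>erlang_law m \<partial>erlang_law (Suc m)) =
    (\<integral>\<^sup>+r. ennreal (exp r) * (\<integral>\<^sup>+t. (if r < t then g (t, real (Suc m) * ln (t / r)) else 0) \<partial>erlang_law (Suc 0)) \<partial>erlang_law (Suc m))"
  proof (intro nn_integral_cong_AE, eventually_elim)
    case (elim r)
    interpret pair_sigma_finite "erlang_law m" "erlang_law (Suc 0)" ..
    have "(\<integral>\<^sup>+l. record_prob A m (Suc k) r l \<partial>erlang_law m) = ennreal (exp r) * (\<integral>\<^sup>+l. \<integral>\<^sup>+t.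
      (if r < t then record_prob A (Suc m) k t (l + real (Suc m) * ln (t / r)) else 0) \<partial>erlang_law (Suc 0) \<partial>erlang_law m)"
      by (simp only: record_prob_Suc[OF assms elim(2)]) (intro nn_integral_cmult, measurable)
    also have "\<dots> = ennreal (exp r) * (\<integral>\<^sup>+t. \<integral>\<^sup>+l.
      (if r < t then record_prob A (Suc m) k t (l + real (Suc m) * ln (t / r)) else 0) \<partial>erlang_law m \<partial>erlang_law (Suc 0))"
      by (subst Fubini') auto
    also have "\<dots> = ennreal (exp r) * (\<integral>\<^sup>+t. (if r < t then g (t, real (Suc m) * ln (t / r)) else 0) \<partial>erlang_law (Suc 0))"
      by (intro arg_cong2[where f="(*)"] nn_integral_cong) (auto simp: g_def)
    finally show ?case .
  qed
  also have "\<dots> = (\<integral>\<^sup>+t. \<integral>\<^sup>+w. g (t, w) \<partial>erlang_law (Suc 0) \<partial>erlang_law (Suc (Suc m)))"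
    by (rule nn_integral_record_step) measurable
  also have "\<dots> = (\<integral>\<^sup>+t. \<integral>\<^sup>+l. record_prob A (Suc m) k t l \<partial>erlang_law (Suc m) \<partial>erlang_law (Suc (Suc m)))"
  proof (rule nn_integral_cong)
    fix t
    interpret pair_sigma_finite "erlang_law m" "erlang_law (Suc 0)" ..
    \<comment> \<open>The independent exponential \<open>w\<close> added to \<open>l\<close> raises
      its shape from \<open>m\<close> to \<open>m + 1\<close>.\<close>
    have "(\<integral>\<^sup>+w. g (t, w) \<partial>erlang_law (Suc 0)) = (\<integral>\<^sup>+l. \<integral>\<^sup>+w. record_prob A (Suc m) k t (l + w) \<partial>erlang_law (Suc 0) \<partial>erlang_law m)"
      unfolding g_def case_prod_conv by (rule Fubini') measurable
    also have "\<dots> = (\<integral>\<^sup>+l. record_prob A (Suc m) k t l \<partial>erlang_law (Suc m))"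
      by (rule nn_integral_erlang_law_convolution) measurable
    finally show "(\<integral>\<^sup>+w. g (t, w) \<partial>erlang_law (Suc 0)) = (\<integral>\<^sup>+l. record_prob A (Suc m) k t l \<partial>erlang_law (Suc m))" .
  qed
  also have "\<dots> = (\<integral>\<^sup>+r. \<integral>\<^sup>+l. indicator A (r, l) \<partial>erlang_law (Suc m + k) \<partial>erlang_law (Suc (Suc m + k)))"
    by (rule Suc.IH)
  finally show ?case by simp
qed

lemma distr_records_log_increments:
  "distr exp_seq (borel \<Otimes>\<^sub>M borel) (\<lambda>x. (records x n, log_increments x 0 n)) =
    erlang_law (Suc n) \<Otimes>\<^sub>M erlang_law n"
proof (rule measure_eqI)
  show "sets (distr exp_seq (borel \<Otimes>\<^sub>M borel) (\<lambda>x. (records x n, log_increments x 0 n))) =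
    sets (erlang_law (Suc n) \<Otimes>\<^sub>M erlang_law n)"
    by (simp cong: sets_pair_measure_cong)
next
  fix A assume "A \<in> sets (distr exp_seq (borel \<Otimes>\<^sub>M borel) (\<lambda>x. (records x n, log_increments x 0 n)))"
  then have [measurable]: "A \<in> sets (borel \<Otimes>\<^sub>M borel)" by simp
  have "emeasure (distr exp_seq (borel \<Otimes>\<^sub>M borel) (\<lambda>x. (records x n, log_increments x 0 n))) A =
    (\<integral>\<^sup>+x. indicator A (records x n, log_increments x 0 n) \<partial>exp_seq)"
    by (subst nn_integral_indicator[symmetric], simp, subst nn_integral_distr) auto
  also have "\<dots> = (\<integral>\<^sup>+r. record_prob A 0 n r 0 \<partial>erlang_law (Suc 0))"
    unfolding record_prob_def by (subst nn_integral_exp_seq) (auto simp del: One_nat_def)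
  \<comment> \<open>The starting value \<open>l = 0\<close> is read as a draw from the point mass of
    shape 0, which brings in the case \<open>m = 0\<close> of the chain lemma.\<close>
  also have "\<dots> = (\<integral>\<^sup>+r. \<integral>\<^sup>+l. record_prob A 0 n r l \<partial>erlang_law 0 \<partial>erlang_law (Suc 0))"
  proof -
    have "(\<integral>\<^sup>+l. record_prob A 0 n r l \<partial>erlang_law 0) = record_prob A 0 n r 0" for r
      unfolding erlang_law_def if_P[OF refl] by (rule nn_integral_return) (auto intro: measurable_record_prob)
    then show ?thesis by simp
  qed
  also have "\<dots> = (\<integral>\<^sup>+r. \<integral>\<^sup>+l. indicator A (r, l) \<partial>erlang_law n \<partial>erlang_law (Suc n))"
    by (subst nn_integral_record_prob) auto
  also have "\<dots> = emeasure (erlang_law (Suc n) \<Otimes>\<^sub>M erlang_law n) A"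
    by (rule erlang.emeasure_pair_measure[symmetric]) simp
  finally show "emeasure (distr exp_seq (borel \<Otimes>\<^sub>M borel) (\<lambda>x. (records x n, log_increments x 0 n))) A =
    emeasure (erlang_law (Suc n) \<Otimes>\<^sub>M erlang_law n) A" .
qed

section \<open>Chi-square quantiles\<close>

text \<open>With \<open>2 * (k + 1)\<close> degrees of freedom the chi-square law is the Gamma law
  of shape \<open>k + 1\<close> and rate 1/2, as \<open>Gamma (k + 1) = fact k\<close>.\<close>

lemma chi_square_even: "chi_square (2 * Suc k) = density lborel (erlang_density k (1 / 2))"
  unfolding chi_square_def
proof (rule density_cong)
  \<comment> \<open>The point 0 is excluded: for \<open>k = 0\<close> the Erlang density is positive
    there, the chi-square density is 0.\<close>
  show "AE x in lborel. ennreal (chi_square_density (2 * Suc k) x) = ennreal (erlang_density k (1 / 2) x)"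
    using AE_lborel_singleton[of 0]
  proof eventually_elim
    case (elim x)
    have half: "real (2 * Suc k) / 2 = real (Suc k)"
      by (simp add: field_simps)
    have "x powr (real (2 * Suc k) / 2 - 1) = x ^ k" if "0 < x"
      unfolding half using that by (simp add: powr_realpow)
    moreover have "(2::real) powr (real (2 * Suc k) / 2) = 2 ^ Suc k"
      unfolding half by (rule powr_realpow) simp
    moreover have "Gamma (real (2 * Suc k) / 2) = fact k"
      unfolding half using Gamma_fact[of k, where 'a=real] by (simp add: add.commute)
    ultimately have "chi_square_density (2 * Suc k) x = erlang_density k (1 / 2) x"
      unfolding chi_square_density_def erlang_density_def using elim
      by (auto simp: field_simps)
    then show ?case by simp
  qed
qed (auto simp: chi_square_density_def[abs_def])

lemma cdf_erlang_law_Suc: "cdf (erlang_law (Suc k)) c = erlang_CDF k 1 c"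
  unfolding cdf_def measure_def erlang_law_Suc by (subst emeasure_erlang_density) auto

lemma cdf_chi_square_even: "cdf (chi_square (2 * Suc k)) c = cdf (erlang_law (Suc k)) (c / 2)"
proof -
  have "cdf (chi_square (2 * Suc k)) c = erlang_CDF k (1 / 2) c"
    unfolding cdf_def measure_def chi_square_even by (subst emeasure_erlang_density) auto
  also have "\<dots> = erlang_CDF k 1 (1 / 2 * c)"
    by (rule erlang_CDF_transform) simp
  finally show ?thesis by (simp add: cdf_erlang_law_Suc)
qed

lemma emeasure_erlang_law_singleton: "emeasure (erlang_law (Suc k)) {x} = 0"
  unfolding erlang_law_Suc
  by (subst emeasure_density, simp, simp, subst nn_integral_0_iff_AE)
    (auto intro: eventually_mono[OF AE_lborel_singleton[of x]])

lemma isCont_cdf_erlang_law: "isCont (cdf (erlang_law (Suc k))) x"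
proof -
  show ?thesis by (simp add: erlang.isCont_cdf measure_def emeasure_erlang_law_singleton)
qed

text \<open>Equality would make \<open>{c<..d}\<close> a null set, although the density is positive
  there and the interval has positive length.\<close>

lemma cdf_erlang_law_strict_mono:
  assumes "0 \<le> c" "c < d"
  shows "cdf (erlang_law (Suc k)) c < cdf (erlang_law (Suc k)) d"
proof (rule ccontr)
  assume "\<not> ?thesis"
  moreover have "cdf (erlang_law (Suc k)) d - cdf (erlang_law (Suc k)) c = measure (erlang_law (Suc k)) {c<..d}"
    using assms by (intro erlang.cdf_diff_eq) auto
  ultimately have "measure (erlang_law (Suc k)) {c<..d} = 0"
    using measure_nonneg[of "erlang_law (Suc k)" "{c<..d}"] by linarith
  then have "emeasure (density lborel (erlang_density k 1)) {c<..d} = 0"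
    by (simp add: erlang.emeasure_eq_measure erlang_law_Suc[symmetric])
  then have "AE x in lborel. ennreal (erlang_density k 1 x) * indicator {c<..d} x = 0"
    by (subst (asm) emeasure_density, simp, simp, subst (asm) nn_integral_0_iff_AE) auto
  then have "AE x in lborel. x \<notin> {c<..d}"
    by eventually_elim (use assms in \<open>auto simp: erlang_density_def indicator_def split: if_splits\<close>)
  then have "emeasure lborel {c<..d} = 0"
    by (subst (asm) AE_iff_measurable[of "{c<..d}"]) auto
  then show False using assms by simp
qed

lemma cdf_erlang_law_nonpos: "c \<le> 0 \<Longrightarrow> cdf (erlang_law (Suc k)) c = 0"
  by (cases "c = 0") (auto simp: cdf_erlang_law_Suc erlang_CDF_at0, simp add: erlang_CDF_def)

text \<open>Justifies the \<open>THE\<close> in the quantile: existence by the intermediate value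
  theorem, uniqueness because the cdf vanishes up to 0 and increases strictly afterwards.\<close>

lemma chi_square_quantile_even:
  fixes k :: nat
  assumes "0 < \<delta>" "\<delta> < 1"
  defines "q \<equiv> chi_square_quantile (2 * Suc k) \<delta>"
  shows "cdf (erlang_law (Suc k)) (q / 2) = \<delta>" and "0 < q"
proof -
  let ?F = "cdf (erlang_law (Suc k))"
  have "eventually (\<lambda>x. \<delta> < ?F x) at_top"
    using erlang.cdf_lim_at_top_prob assms(2) by (rule order_tendstoD)
  then obtain b where "\<delta> < ?F b" by (auto simp: eventually_at_top_linorder)
  then have b: "?F 0 \<le> \<delta>" "\<delta> \<le> ?F b" "0 \<le> b"
    using assms(1) cdf_erlang_law_nonpos[of 0 k] cdf_erlang_law_nonpos[of b k] by force+
  obtain c where c: "?F c = \<delta>"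
    using IVT[of ?F 0 \<delta> b] b isCont_cdf_erlang_law by blast
  have pos: "0 < a" if "?F a = \<delta>" for a
    using that assms cdf_erlang_law_nonpos[of a k] by (cases "a \<le> 0") auto
  have uniq: "a = c" if "?F a = \<delta>" for a
    using pos[OF that] pos[OF c] that c cdf_erlang_law_strict_mono[of a c k]
      cdf_erlang_law_strict_mono[of c a k] by (cases a c rule: linorder_cases) auto
  have "q = 2 * c"
    unfolding q_def chi_square_quantile_def cdf_chi_square_even
    by (rule the_equality) (use c uniq in force)+
  then show "?F (q / 2) = \<delta>" "0 < q"
    using c pos[OF c] by auto
qed

lemma measure_erlang_law_between_quantiles:
  assumes "0 < s" "s < 1"
  shows "measure (erlang_law (Suc k)) {chi_square_quantile (2 * Suc k) ((1 - s) / 2) / 2 <..<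
    chi_square_quantile (2 * Suc k) ((1 + s) / 2) / 2} = s"
proof -
  let ?F = "cdf (erlang_law (Suc k))"
  define a where "a = chi_square_quantile (2 * Suc k) ((1 - s) / 2) / 2"
  define b where "b = chi_square_quantile (2 * Suc k) ((1 + s) / 2) / 2"
  have F: "?F a = (1 - s) / 2" "?F b = (1 + s) / 2"
    unfolding a_def b_def using assms by (intro chi_square_quantile_even(1); simp)+
  then have "?F a < ?F b" using assms by simp
  then have "a < b" using erlang.cdf_nondecreasing[of b a "Suc k"] by linarith
  \<comment> \<open>The cdf difference measures a half-open interval; its right endpoint carries no
    mass.\<close>
  have "measure (erlang_law (Suc k)) {a<..<b} = measure (erlang_law (Suc k)) {a<..b}"
  proof -
    have "{a<..b} = {a<..<b} \<union> {b}" using \<open>a < b\<close> by auto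
    then have "emeasure (erlang_law (Suc k)) {a<..b} = emeasure (erlang_law (Suc k)) {a<..<b}"
      by (simp add: emeasure_Un_null_set null_sets_def emeasure_erlang_law_singleton del: Un_insert_right)
    then show ?thesis by (simp add: measure_def)
  qed
  also have "\<dots> = s"
    using erlang.cdf_diff_eq[OF \<open>a < b\<close>] F by (simp add: field_simps)
  finally show ?thesis by (simp add: a_def b_def)
qed

section \<open>From Weibull to exponential observations\<close>

lemma powr_less_iff_less:
  fixes x y b :: real
  assumes "0 < b" "0 < x" "0 < y"
  shows "x powr b < y powr b \<longleftrightarrow> x < y"
  using assms powr_less_mono2[of b x y] powr_less_mono2[of b y x]
  by (cases x y rule: linorder_cases) auto

text \<open>Raising to the power \<open>\<beta>\<close> and solving for the pivot
  \<open>(R / \<alpha>) powr \<beta>\<close> reverses the bounds: a lower bound on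
  \<open>\<alpha>\<close> is an upper bound on the pivot.\<close>

lemma scale_bounds_iff:
  fixes R \<alpha> \<beta> d :: real
  assumes "0 < R" "0 < \<alpha>" "0 < \<beta>" "0 < d"
  shows "R * (2 / d) powr (1 / \<beta>) < \<alpha> \<longleftrightarrow> (R / \<alpha>) powr \<beta> < d / 2"
    and "\<alpha> < R * (2 / d) powr (1 / \<beta>) \<longleftrightarrow> d / 2 < (R / \<alpha>) powr \<beta>"
proof -
  have u: "(R * (2 / d) powr (1 / \<beta>)) powr \<beta> = R powr \<beta> * (2 / d)"
    using assms by (simp add: powr_mult powr_powr)
  have "R * (2 / d) powr (1 / \<beta>) < \<alpha> \<longleftrightarrow> R powr \<beta> * (2 / d) < \<alpha> powr \<beta>"
    unfolding u[symmetric] using assms by (subst powr_less_iff_less) auto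
  then show "R * (2 / d) powr (1 / \<beta>) < \<alpha> \<longleftrightarrow> (R / \<alpha>) powr \<beta> < d / 2"
    using assms by (simp add: powr_divide field_simps)
  have "\<alpha> < R * (2 / d) powr (1 / \<beta>) \<longleftrightarrow> \<alpha> powr \<beta> < R powr \<beta> * (2 / d)"
    unfolding u[symmetric] using assms by (subst powr_less_iff_less) auto
  then show "\<alpha> < R * (2 / d) powr (1 / \<beta>) \<longleftrightarrow> d / 2 < (R / \<alpha>) powr \<beta>"
    using assms by (simp add: powr_divide field_simps)
qed

text \<open>The identity on the nonpositive half-line makes the map strictly monotone everywhere, so it
  commutes with taking records without any exceptional null set.\<close>

definition weibull_to_exp :: "real \<Rightarrow> real \<Rightarrow> real \<Rightarrow> real" where
  "weibull_to_exp \<alpha> \<beta> x = (if 0 < x then (x / \<alpha>) powr \<beta> else x)"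

lemma measurable_weibull_to_exp [measurable]: "weibull_to_exp \<alpha> \<beta> \<in> borel_measurable borel"
  unfolding weibull_to_exp_def by measurable

lemma strict_mono_weibull_to_exp:
  assumes "0 < \<alpha>" "0 < \<beta>"
  shows "strict_mono (weibull_to_exp \<alpha> \<beta>)"
proof (rule strict_monoI)
  fix x y :: real assume "x < y"
  then show "weibull_to_exp \<alpha> \<beta> x < weibull_to_exp \<alpha> \<beta> y"
    using assms by (auto simp: weibull_to_exp_def powr_less_iff_less divide_strict_right_mono
        intro: le_less_trans[of x 0])
qed

lemma weibull_to_exp_pos_iff: "0 < \<alpha> \<Longrightarrow> 0 < weibull_to_exp \<alpha> \<beta> x \<longleftrightarrow> 0 < x"
  by (simp add: weibull_to_exp_def)

lemma distr_weibull_to_exp: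
  assumes "prob_space M" and [measurable]: "X \<in> borel_measurable M"
    and "0 < \<alpha>" "0 < \<beta>" and cdf: "cdf (distr M borel X) = weibull_cdf \<alpha> \<beta>"
  shows "distr M borel (\<lambda>\<omega>. weibull_to_exp \<alpha> \<beta> (X \<omega>)) = erlang_law (Suc 0)"
proof -
  interpret prob_space M by fact
  have "distributed M lborel (\<lambda>\<omega>. weibull_to_exp \<alpha> \<beta> (X \<omega>)) (exponential_density 1)"
  proof (rule exponential_distributedI)
    fix a :: real assume a: "0 \<le> a"
    \<comment> \<open>The preimage of \<open>a\<close>. For \<open>a = 0\<close> the power is 0, and
      the identity branch of the map fixes 0.\<close>
    define c where "c = \<alpha> * a powr (1 / \<beta>)"
    have c: "0 \<le> c" "weibull_to_exp \<alpha> \<beta> c = a"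
      using a assms by (auto simp: c_def weibull_to_exp_def powr_powr zero_less_mult_iff)
    have "weibull_to_exp \<alpha> \<beta> x \<le> a \<longleftrightarrow> x \<le> c" for x
      using strict_mono_less_eq[OF strict_mono_weibull_to_exp[OF assms(3,4)], of x c] c by simp
    then have "emeasure M {\<omega> \<in> space M. weibull_to_exp \<alpha> \<beta> (X \<omega>) \<le> a} = ennreal (cdf (distr M borel X) c)"
      by (simp add: cdf_def measure_distr emeasure_eq_measure vimage_def Int_def conj_commute)
    also have "cdf (distr M borel X) c = 1 - exp (- a * 1)"
      using c by (auto simp: cdf weibull_cdf_def weibull_to_exp_def split: if_splits)
    finally show "emeasure M {\<omega> \<in> space M. weibull_to_exp \<alpha> \<beta> (X \<omega>) \<le> a} = 1 - ennreal (exp (- a * 1))"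
      using a by (simp add: ennreal_minus[symmetric] flip: ennreal_1)
  qed auto
  then have "distr M lborel (\<lambda>\<omega>. weibull_to_exp \<alpha> \<beta> (X \<omega>)) = erlang_law (Suc 0)"
    by (simp add: distributed_def erlang_law_Suc)
  then show ?thesis by (simp cong: distr_cong)
qed

text \<open>A pathwise statement: at the true parameters the pivots are
  \<open>(R_n / \<alpha>) powr \<beta>\<close> and \<open>\<beta>\<close> times the sum of log
  ratios, so membership is two interval conditions free of parameters.\<close>

lemma confidence_region_iff:
  fixes y :: "nat \<Rightarrow> real"
  assumes pos: "0 < \<alpha>" "0 < \<beta>" and n: "1 \<le> n" and s: "0 < \<gamma>" "\<gamma> < 1"
    and y: "\<And>r. \<exists>j. r < y j" "0 < y 0" "\<And>j. y j = weibull_to_exp \<alpha> \<beta> (x j)"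
  shows "(\<alpha>, \<beta>) \<in> confidence_region n \<gamma> (records x) \<longleftrightarrow>
    records y n \<in> {chi_square_quantile (2 * Suc n) ((1 - sqrt (1 - \<gamma>)) / 2) / 2 <..<
      chi_square_quantile (2 * Suc n) ((1 + sqrt (1 - \<gamma>)) / 2) / 2} \<and>
    log_increments y 0 n \<in> {chi_square_quantile (2 * n) ((1 - sqrt (1 - \<gamma>)) / 2) / 2 <..<
      chi_square_quantile (2 * n) ((1 + sqrt (1 - \<gamma>)) / 2) / 2}"
proof -
  define D where "D = (\<Sum>i=0..n. ln (records x n / records x i))"
  have rec: "records y k = weibull_to_exp \<alpha> \<beta> (records x k)" for k
    using records_strict_mono_comp[OF strict_mono_weibull_to_exp[OF pos], of x k] by (simp add: y(3)[symmetric])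
  have "0 < records y k" for k
    using records_mono[OF y(1), of 0 k] y(2) by simp
  then have x_pos: "0 < records x k" for k
    by (simp add: rec weibull_to_exp_pos_iff pos)
  then have rec': "records y k = (records x k / \<alpha>) powr \<beta>" for k
    by (simp add: rec weibull_to_exp_def)
  have lt: "records x 0 < records x n"
  proof -
    have "records y 0 < records y 1"
      using records_less_Suc[OF y(1), of 0] by simp
    also have "\<dots> \<le> records y n" by (rule records_mono[OF y(1) n])
    finally show ?thesis
      unfolding rec by (simp add: strict_mono_less[OF strict_mono_weibull_to_exp[OF pos]])
  qed
  have le: "records x i \<le> records x n" if "i \<le> n" for i
    using records_mono[OF y(1) that] unfolding rec
    by (simp add: strict_mono_less_eq[OF strict_mono_weibull_to_exp[OF pos]])
  \<comment> \<open>The summand \<open>i = 0\<close> is strictly positive because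
    \<open>1 \<le> n\<close> forces a strict increase after the initial record. Positivity lets the
    bounds on \<open>b\<close> be multiplied through by \<open>2 * D\<close>.\<close>
  have D: "0 < D"
    unfolding D_def using lt le x_pos
    by (intro sum_pos2[of _ 0] ln_gt_zero ln_ge_zero) (auto simp del: records_0)
  have "log_increments y 0 n = (\<Sum>i=0..n. ln (records y n / records y i))"
    by (rule log_increments_eq[OF y(1,2)])
  also have "\<dots> = (\<Sum>i=0..n. \<beta> * ln (records x n / records x i))"
  proof (intro sum.cong refl)
    fix i
    have "records y n / records y i = (records x n / records x i) powr \<beta>"
      unfolding rec' using x_pos[of n] x_pos[of i] pos by (simp add: powr_divide)
    then show "ln (records y n / records y i) = \<beta> * ln (records x n / records x i)"
      using x_pos[of n] x_pos[of i] by simp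
  qed
  finally have L: "log_increments y 0 n = \<beta> * D"
    by (simp add: D_def sum_distrib_left)
  have q: "0 < chi_square_quantile (2 * Suc n) ((1 - sqrt (1 - \<gamma>)) / 2)"
    "0 < chi_square_quantile (2 * Suc n) ((1 + sqrt (1 - \<gamma>)) / 2)"
  proof -
    have pos: "0 < chi_square_quantile (2 * Suc n) ((1 - u) / 2)"
      "0 < chi_square_quantile (2 * Suc n) ((1 + u) / 2)" if "0 < u" "u < 1" for u
      using that by (auto intro!: chi_square_quantile_even(2) simp del: mult_Suc_right)
    show "0 < chi_square_quantile (2 * Suc n) ((1 - sqrt (1 - \<gamma>)) / 2)"
      "0 < chi_square_quantile (2 * Suc n) ((1 + sqrt (1 - \<gamma>)) / 2)"
      using s by (intro pos; simp)+
  qed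
  show ?thesis
    unfolding confidence_region_def L rec' D_def[symmetric]
    using pos D scale_bounds_iff[OF x_pos pos q(1)] scale_bounds_iff[OF x_pos pos q(2)]
    by (auto simp: field_simps)
qed

section \<open>Coverage probability of the region\<close>

theorem mainTheorem5:
  fixes M :: "'a measure" and X :: "nat \<Rightarrow> 'a \<Rightarrow> real" and \<alpha> \<beta> \<gamma> :: real and n :: nat
  assumes "prob_space M"
    and "\<alpha> > 0" and "\<beta> > 0" and "n \<ge> 1" and "0 < \<gamma>" and "\<gamma> < 1"
    and "prob_space.indep_vars M (\<lambda>_. borel) X UNIV"
    and "\<And>j. cdf (distr M borel (X j)) = weibull_cdf \<alpha> \<beta>"
  shows "measure M {\<omega> \<in> space M. (\<alpha>, \<beta>) \<in> confidence_region n \<gamma> (\<lambda>i. record_value X i \<omega>)} = 1 - \<gamma>"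
proof -
  interpret prob_space M by fact
  define Y where "Y = (\<lambda>\<omega> j. weibull_to_exp \<alpha> \<beta> (X j \<omega>))"
  \<comment> \<open>The level of each single pivot interval; independence will give the coverage
    \<open>s * s = 1 - \<gamma>\<close>.\<close>
  define s where "s = sqrt (1 - \<gamma>)"
  have s: "0 < s" "s < 1" "s * s = 1 - \<gamma>"
    using assms(5,6) by (auto simp: s_def)
  define A where "A = {chi_square_quantile (2 * Suc n) ((1 - s) / 2) / 2 <..<
    chi_square_quantile (2 * Suc n) ((1 + s) / 2) / 2}"
  define B where "B = {chi_square_quantile (2 * n) ((1 - s) / 2) / 2 <..<
    chi_square_quantile (2 * n) ((1 + s) / 2) / 2}"
  have X_meas [measurable]: "X j \<in> borel_measurable M" for j
    using assms(7) by (auto simp: indep_vars_def)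
  have Y_meas [measurable]: "Y \<in> measurable M (PiM UNIV (\<lambda>_. borel))"
    unfolding Y_def by (intro measurable_PiM_single') auto
  have "indep_vars (\<lambda>_. borel) (\<lambda>j \<omega>. weibull_to_exp \<alpha> \<beta> (X j \<omega>)) UNIV"
    by (rule indep_vars_compose2[OF assms(7)]) measurable
  then have "distr M (PiM UNIV (\<lambda>_. borel)) Y =
    PiM UNIV (\<lambda>j. distr M borel (\<lambda>\<omega>. weibull_to_exp \<alpha> \<beta> (X j \<omega>)))"
    by (subst (asm) indep_vars_iff_distr_eq_PiM) (auto simp: Y_def restrict_def)
  also have "\<dots> = exp_seq"
    by (simp add: distr_weibull_to_exp[OF assms(1) X_meas assms(2,3,8)])
  finally have Y: "distr M exp_seq Y = exp_seq"
    by (simp cong: distr_cong add: sets_exp_seq)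
  have [measurable]: "Y \<in> measurable M exp_seq"
    using Y_meas by (simp cong: measurable_cong_sets add: sets_exp_seq)

  \<comment> \<open>The path properties required by the pathwise equivalence, transported from the
    exponential sequence along \<open>Y\<close>.\<close>
  have AE: "AE \<omega> in M. (\<forall>r. \<exists>j. r < Y \<omega> j) \<and> 0 < Y \<omega> 0"
  proof -
    have "AE x in exp_seq. 0 < x 0"
    proof -
      have "AE x in erlang_law (Suc 0). 0 < x"
        unfolding erlang_law_Suc
        by (subst AE_density, simp, rule eventually_mono[OF AE_lborel_singleton[of 0]])
          (auto simp: erlang_density_def split: if_splits)
      then show ?thesis
        by (intro AE_PiM_component) (auto intro: prob_space_erlang_law)
    qed
    with AE_exp_seq_unbounded have "AE x in exp_seq. (\<forall>r. \<exists>j. r < x j) \<and> 0 < x 0"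
      by eventually_elim simp
    then have "AE x in distr M exp_seq Y. (\<forall>r. \<exists>j. r < x j) \<and> 0 < x 0"
      by (simp only: Y)
    then show ?thesis
      by (rule AE_distrD[rotated]) measurable
  qed

  \<comment> \<open>Off the null set just found, the coverage event is the event that the pivots lie
    in the rectangle \<open>A \<times> B\<close>.\<close>
  have "prob {\<omega> \<in> space M. (\<alpha>, \<beta>) \<in> confidence_region n \<gamma> (\<lambda>i. record_value X i \<omega>)} =
    prob {\<omega> \<in> space M. (records (Y \<omega>) n, log_increments (Y \<omega>) 0 n) \<in> A \<times> B}"
  proof (rule measure_eq_AE)
    show "AE \<omega> in M. \<omega> \<in> {\<omega> \<in> space M. (\<alpha>, \<beta>) \<in> confidence_region n \<gamma> (\<lambda>i. record_value X i \<omega>)} \<longleftrightarrow>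
      \<omega> \<in> {\<omega> \<in> space M. (records (Y \<omega>) n, log_increments (Y \<omega>) 0 n) \<in> A \<times> B}"
      using AE
    proof eventually_elim
      case (elim \<omega>)
      then have "(\<alpha>, \<beta>) \<in> confidence_region n \<gamma> (records (\<lambda>j. X j \<omega>)) \<longleftrightarrow>
        records (Y \<omega>) n \<in> A \<and> log_increments (Y \<omega>) 0 n \<in> B"
        unfolding A_def B_def s_def
        by (intro confidence_region_iff[OF assms(2-6)]) (auto simp: Y_def)
      then show ?case
        by (simp add: record_value_eq_records)
    qed
    have rec [measurable]: "(\<lambda>\<omega>. records (\<lambda>j. X j \<omega>) i) \<in> borel_measurable M" for i
      by (rule measurable_compose[OF _ measurable_records]) (auto intro!: measurable_PiM_single')
    show "{\<omega> \<in> space M. (\<alpha>, \<beta>) \<in> confidence_region n \<gamma> (\<lambda>i. record_value X i \<omega>)} \<in> events"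
      unfolding confidence_region_def record_value_eq_records by simp measurable
    show "{\<omega> \<in> space M. (records (Y \<omega>) n, log_increments (Y \<omega>) 0 n) \<in> A \<times> B} \<in> events"
      unfolding A_def B_def by measurable
  qed
  also have "\<dots> = measure (distr M (borel \<Otimes>\<^sub>M borel) (\<lambda>\<omega>. (records (Y \<omega>) n, log_increments (Y \<omega>) 0 n))) (A \<times> B)"
    by (subst measure_distr) (auto simp: A_def B_def intro!: arg_cong[where f=prob])
  also have "distr M (borel \<Otimes>\<^sub>M borel) (\<lambda>\<omega>. (records (Y \<omega>) n, log_increments (Y \<omega>) 0 n)) =
    distr (distr M exp_seq Y) (borel \<Otimes>\<^sub>M borel) (\<lambda>x. (records x n, log_increments x 0 n))"
    by (subst distr_distr) (auto simp: comp_def)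
  also have "\<dots> = erlang_law (Suc n) \<Otimes>\<^sub>M erlang_law n"
    unfolding Y by (rule distr_records_log_increments)
  also have "measure (erlang_law (Suc n) \<Otimes>\<^sub>M erlang_law n) (A \<times> B) =
    measure (erlang_law (Suc n)) A * measure (erlang_law n) B"
    unfolding measure_def by (subst erlang.emeasure_pair_measure_Times) (auto simp: A_def B_def enn2real_mult)
  also have "measure (erlang_law (Suc n)) A = s"
    unfolding A_def by (rule measure_erlang_law_between_quantiles[OF s(1,2)])
  \<comment> \<open>Quantiles were treated for positive shapes \<open>Suc k\<close>; here
    \<open>k = n - 1\<close>, with \<open>n \<ge> 1\<close>.\<close>
  also have "measure (erlang_law n) B = s"
    using measure_erlang_law_between_quantiles[OF s(1,2), of "n - 1"] assms(4) by (simp add: B_def)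
  finally show ?thesis by (simp add: s)
qed

end
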